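(* For any fixed $\alpha\in(0,\alpha_0)$ and $\sigma\in(0,\sigma_0]$ there exists a critical angle $$\beta_c=\arcsin\!\left(\frac{-\xi_{1P_2}}{\cot\sigma}\right)\in(0,\pi/2),$$ where $\xi_{1P_2}<0$ is the $\xi_1$-coordinate of the point $P_2$ in which $\mathcal{C}_\infty$ meets the negative $\xi_1$-axis, such that for $\beta=\beta_c$ the point $P_1^\beta$ at which the oblique shock line $S^\beta_{ob}$ is tangent to $\mathcal{C}_\infty$ coincides with $P_2$, and the curved shock (the arc of $\mathcal{C}_\infty$ between $P_1^\beta$ and $P_2$) vanishes; that is, the attached shock becomes planar.
   Context: Flow data. The gas is a Chaplygin gas with sound speed $c=a/\rho$ ($a>0$ constant). The incoming flow has density $\rho_\infty>0$, sound speed $c_\infty=a/\rho_\infty$, speed $q_\infty>c_\infty$, normalized by $q_\infty^2-c_\infty^2=1$; for an attack angle $\alpha\in(0,\pi/2)$ its velocity is $(v_{1\infty},0,v_{3\infty})=(q_\infty\sin\alpha,0,q_\infty\cos\alpha)$. The critical angles are $$\alpha_0=\arcsin\left(\frac{c_\infty}{q_\infty}\right),\qquad \sigma_0=\arcsin\left(\frac{\sqrt{q_\infty^2-c_\infty^2}}{v_{3\infty}}\right).$$ Wing. For sweep angle $\sigma$ and anhedral angle $\beta\in(0,\pi/2)$ the wing is $\{x_1=-|x_2|\tan\beta,\ |x_2|<x_3\cot\sigma\cos\beta,\ x_3>0\}$. Conical coordinates are $\bm{\xi}=(\xi_1,\xi_2)=(x_1/x_3,x_2/x_3)$; the leading edge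 in $x_2>0$ corresponds to $P_5^\beta=(-\cot\sigma\sin\beta,\cot\sigma\cos\beta)$, and the problem is symmetric about the $\xi_1$-axis, so only $\xi_2\ge 0$ is considered. Uniform flow behind the oblique shock. Let $\bm{e}_j=(-\cos\sigma\sin\beta,\cos\sigma\cos\beta,\sin\sigma)$, $\bm{e}_k=(\sin\sigma\sin\beta,-\sin\sigma\cos\beta,\cos\sigma)$, $$\tilde q_\infty=\sqrt{v_{1\infty}^2\cos^2\beta+(v_{1\infty}\sin\sigma\sin\beta+v_{3\infty}\cos\sigma)^2},\qquad \theta_n=\arctan\left(\frac{\cos\beta}{\sin\sigma\sin\beta+\cot\alpha\cos\sigma}\right).$$ By the Chaplygin shock polar, the speed behind the shock in the direction $\bm{e}_k$ is $q^\beta_{j\sigma}=\sqrt{u_1^2+v_1^2}$ with $$u_1=\frac{u_0\sqrt{u_0^2-c_0^2}}{\sqrt{u_0^2-c_0^2}+c_0\tan\theta},\quad v_1=u_1\tan\theta,\qquad u_0=\tilde q_\infty,\ c_0=c_\infty,\ \theta=\theta_n .$$ The uniform downstream velocity is $$(v^\beta_{1\sigma},v^\beta_{2\sigma},v^\beta_{3\sigma})=(v_{3\infty}\sin\sigma-v_{1\infty}\cos\sigma\sin\beta)\,\bm{e}_j+q^\beta_{j\sigma}\,\bm{e}_k .$$ Put $\phi_\infty(\bm{\xi})=v_{1\infty}\xi_1+v_{3\infty}$ and $\phi^\beta_\sigma(\bm{\xi})=v^\beta_{1\sigma}\xi_1+v^\beta_{2\sigma}\xi_2+v^\beta_{3\sigma}$.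 Shock and Mach cones. The oblique shock $S^\beta_{ob}$ lies on the line $\phi_\infty=\phi^\beta_\sigma$ and starts at the leading edge $P_5^\beta$. The Mach cone of the incoming flow is the curve $\mathcal{C}_\infty:\ \phi_\infty^2=1+|\bm{\xi}|^2$ (branch $\phi_\infty>0$), and that of the downstream flow is $\mathcal{C}^\beta_\sigma:\ (\phi^\beta_\sigma)^2=1+|\bm{\xi}|^2$ (branch $\phi^\beta_\sigma>0$). The line $S^\beta_{ob}$ is tangent to $\mathcal{C}_\infty$ at $P_1^\beta$. As long as $P_1^\beta$ lies in $\xi_2\ge0$, the attached shock in $\xi_2\ge0$ is the union of the segment $P_5^\beta P_1^\beta$ of $S^\beta_{ob}$ and the arc $P_1^\beta P_2$ of $\mathcal{C}_\infty$. *)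

theory Defs
  imports "HOL-Analysis.Analysis"
begin

text \<open>
  Parameters: \<open>c\<close> and \<open>q\<close> are the sound speed and the speed of the incoming flow, \<open>\<alpha>\<close> the attack
  angle, \<open>\<sigma>\<close> the sweep angle, \<open>\<beta>\<close> the anhedral angle. Physical space and velocities live in
  \<open>real^3\<close>, conical coordinates \<open>\<xi> = (x1/x3, x2/x3)\<close> in \<open>real^2\<close>.
\<close>

definition sound_speed :: "real \<Rightarrow> real \<Rightarrow> real" where
  "sound_speed a \<rho> = a / \<rho>"

definition v1_inf :: "real \<Rightarrow> real \<Rightarrow> real" where
  "v1_inf q \<alpha> = q * sin \<alpha>"

definition v3_inf :: "real \<Rightarrow> real \<Rightarrow> real" where
  "v3_inf q \<alpha> = q * cos \<alpha>"

definition vel_inf :: "real \<Rightarrow> real \<Rightarrow> real^3" where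
  "vel_inf q \<alpha> = vector [v1_inf q \<alpha>, 0, v3_inf q \<alpha>]"

definition alpha0 :: "real \<Rightarrow> real \<Rightarrow> real" where
  "alpha0 c q = arcsin (c / q)"

definition sigma0 :: "real \<Rightarrow> real \<Rightarrow> real \<Rightarrow> real" where
  "sigma0 c q \<alpha> = arcsin (sqrt (q\<^sup>2 - c\<^sup>2) / v3_inf q \<alpha>)"

definition P5 :: "real \<Rightarrow> real \<Rightarrow> real^2" where
  "P5 \<sigma> \<beta> = vector [- cot \<sigma> * sin \<beta>, cot \<sigma> * cos \<beta>]"

definition e_j :: "real \<Rightarrow> real \<Rightarrow> real^3" where
  "e_j \<sigma> \<beta> = vector [- cos \<sigma> * sin \<beta>, cos \<sigma> * cos \<beta>, sin \<sigma>]"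

definition e_k :: "real \<Rightarrow> real \<Rightarrow> real^3" where
  "e_k \<sigma> \<beta> = vector [sin \<sigma> * sin \<beta>, - sin \<sigma> * cos \<beta>, cos \<sigma>]"

definition q_tilde :: "real \<Rightarrow> real \<Rightarrow> real \<Rightarrow> real \<Rightarrow> real" where
  "q_tilde q \<alpha> \<sigma> \<beta> =
     sqrt ((v1_inf q \<alpha>)\<^sup>2 * (cos \<beta>)\<^sup>2
           + (v1_inf q \<alpha> * sin \<sigma> * sin \<beta> + v3_inf q \<alpha> * cos \<sigma>)\<^sup>2)"

definition theta_n :: "real \<Rightarrow> real \<Rightarrow> real \<Rightarrow> real" where
  "theta_n \<alpha> \<sigma> \<beta> = arctan (cos \<beta> / (sin \<sigma> * sin \<beta> + cot \<alpha> * cos \<sigma>))"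

text \<open>Chaplygin shock polar: downstream velocity components for the upstream speed \<open>u0\<close>, the upstream
  sound speed \<open>c0\<close> and the turning angle \<open>\<theta>\<close>.\<close>

definition polar_u :: "real \<Rightarrow> real \<Rightarrow> real \<Rightarrow> real" where
  "polar_u u0 c0 \<theta> = u0 * sqrt (u0\<^sup>2 - c0\<^sup>2) / (sqrt (u0\<^sup>2 - c0\<^sup>2) + c0 * tan \<theta>)"

definition polar_v :: "real \<Rightarrow> real \<Rightarrow> real \<Rightarrow> real" where
  "polar_v u0 c0 \<theta> = polar_u u0 c0 \<theta> * tan \<theta>"

definition q_down :: "real \<Rightarrow> real \<Rightarrow> real \<Rightarrow> real \<Rightarrow> real \<Rightarrow> real" where
  "q_down c q \<alpha> \<sigma> \<beta> =
     (let u0 = q_tilde q \<alpha> \<sigma> \<beta>; \<theta> = theta_n \<alpha> \<sigma> \<beta>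
      in sqrt ((polar_u u0 c \<theta>)\<^sup>2 + (polar_v u0 c \<theta>)\<^sup>2))"

definition vel_down :: "real \<Rightarrow> real \<Rightarrow> real \<Rightarrow> real \<Rightarrow> real \<Rightarrow> real^3" where
  "vel_down c q \<alpha> \<sigma> \<beta> =
     (v3_inf q \<alpha> * sin \<sigma> - v1_inf q \<alpha> * cos \<sigma> * sin \<beta>) *\<^sub>R e_j \<sigma> \<beta>
     + q_down c q \<alpha> \<sigma> \<beta> *\<^sub>R e_k \<sigma> \<beta>"

text \<open>Conical potential of the uniform flow with velocity \<open>w\<close>: \<open>conical_pot (vel_inf q \<alpha>)\<close> is
  \<open>\<phi>\<^sub>\<infinity>\<close> and \<open>conical_pot (vel_down c q \<alpha> \<sigma> \<beta>)\<close> is the potential behind the oblique shock.\<close>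

definition conical_pot :: "real^3 \<Rightarrow> real^2 \<Rightarrow> real" where
  "conical_pot w \<xi> = w$1 * \<xi>$1 + w$2 * \<xi>$2 + w$3"

definition mach_cone :: "real^3 \<Rightarrow> (real^2) set" where
  "mach_cone w = {\<xi>. conical_pot w \<xi> > 0 \<and> (conical_pot w \<xi>)\<^sup>2 = 1 + (norm \<xi>)\<^sup>2}"

definition C_inf :: "real \<Rightarrow> real \<Rightarrow> (real^2) set" where
  "C_inf q \<alpha> = mach_cone (vel_inf q \<alpha>)"

definition S_ob :: "real \<Rightarrow> real \<Rightarrow> real \<Rightarrow> real \<Rightarrow> real \<Rightarrow> (real^2) set" where
  "S_ob c q \<alpha> \<sigma> \<beta> =
     {\<xi>. conical_pot (vel_inf q \<alpha>) \<xi> = conical_pot (vel_down c q \<alpha> \<sigma> \<beta>) \<xi>}"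

text \<open>\<open>L\<close> is the tangent line at \<open>P\<close> of the plane curve \<open>C\<close> (a regular curve given as a point set):
  \<open>L\<close> is the line through \<open>P\<close> spanned by the nonzero velocity at \<open>P\<close> of a parametrized curve in \<open>C\<close>.\<close>

definition tangent_line_at :: "(real^2) set \<Rightarrow> (real^2) set \<Rightarrow> real^2 \<Rightarrow> bool" where
  "tangent_line_at L C P \<longleftrightarrow>
     (\<exists>\<gamma> :: real \<Rightarrow> real^2. \<exists>v. \<gamma> 0 = P \<and> (\<forall>\<^sub>F t in nhds 0. \<gamma> t \<in> C) \<and>
        (\<gamma> has_vector_derivative v) (at 0) \<and> v \<noteq> 0 \<and> L = range (\<lambda>t. P + t *\<^sub>R v))"

definition xi1_P2 :: "real \<Rightarrow> real \<Rightarrow> real" where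
  "xi1_P2 q \<alpha> = (THE x. x < 0 \<and> vector [x, 0] \<in> C_inf q \<alpha>)"

definition P2 :: "real \<Rightarrow> real \<Rightarrow> real^2" where
  "P2 q \<alpha> = vector [xi1_P2 q \<alpha>, 0]"

definition P1 :: "real \<Rightarrow> real \<Rightarrow> real \<Rightarrow> real \<Rightarrow> real \<Rightarrow> real^2" where
  "P1 c q \<alpha> \<sigma> \<beta> = (THE P. tangent_line_at (S_ob c q \<alpha> \<sigma> \<beta>) (C_inf q \<alpha>) P)"

text \<open>In the half plane \<open>\<xi>\<^sub>2 \<ge> 0\<close> the curve \<open>C_inf q \<alpha>\<close> is a graph over the \<open>\<xi>\<^sub>1\<close>-axis, so its arc
  between two points consists of the points whose \<open>\<xi>\<^sub>1\<close>-coordinate lies between theirs.\<close>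

definition curved_shock :: "real \<Rightarrow> real \<Rightarrow> real \<Rightarrow> real \<Rightarrow> real \<Rightarrow> (real^2) set" where
  "curved_shock c q \<alpha> \<sigma> \<beta> =
     {\<xi> \<in> C_inf q \<alpha>. \<xi>$2 \<ge> 0 \<and> \<xi>$1 \<in> closed_segment (P1 c q \<alpha> \<sigma> \<beta> $ 1) (P2 q \<alpha> $ 1)}"

text \<open>The part of the attached shock in \<open>\<xi>\<^sub>2 \<ge> 0\<close>; meaningful when \<open>P1\<close> has \<open>\<xi>\<^sub>2 \<ge> 0\<close>.\<close>

definition attached_shock :: "real \<Rightarrow> real \<Rightarrow> real \<Rightarrow> real \<Rightarrow> real \<Rightarrow> (real^2) set" where
  "attached_shock c q \<alpha> \<sigma> \<beta> =
     closed_segment (P5 \<sigma> \<beta>) (P1 c q \<alpha> \<sigma> \<beta>) \<union> curved_shock c q \<alpha> \<sigma> \<beta>"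

text \<open>The whole conical shock surface in physical space; \<open>\<bar>x\<^sub>2\<bar>\<close> accounts for the symmetry about the
  \<open>\<xi>\<^sub>1\<close>-axis.\<close>

definition shock_surface :: "real \<Rightarrow> real \<Rightarrow> real \<Rightarrow> real \<Rightarrow> real \<Rightarrow> (real^3) set" where
  "shock_surface c q \<alpha> \<sigma> \<beta> =
     {x. x$3 > 0 \<and> vector [x$1 / x$3, \<bar>x$2\<bar> / x$3] \<in> attached_shock c q \<alpha> \<sigma> \<beta>}"

definition planar :: "(real^3) set \<Rightarrow> bool" where
  "planar S \<longleftrightarrow> (\<exists>n d. n \<noteq> 0 \<and> S \<subseteq> {x. n \<bullet> x = d})"

end

theory Submission
  imports Defs
begin

text \<open>
  Write \<open>v1\<close>, \<open>v3\<close> for the components of the incoming velocity and \<open>X\<close> for the \<open>\<xi>\<^sub>1\<close>-coordinate of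
  \<open>P2\<close>. The choice \<open>sin \<beta>\<^sub>c = - X / cot \<sigma>\<close> puts the leading edge \<open>P5\<close> vertically above \<open>P2\<close>. For this
  angle the shock polar gives the downstream velocity \<open>(0, 0, v1 * X + v3)\<close>, so the oblique shock
  line is \<open>\<xi>\<^sub>1 = X\<close>. By symmetry this is the tangent of the Mach cone at \<open>P2\<close>, and it meets the
  Mach cone nowhere else.
\<close>

section \<open>Plane vectors, cotangent, arcsine and the shock polar\<close>

lemma vector_2_eq_iff: "(\<xi> :: 'a::zero^2) = vector [x, y] \<longleftrightarrow> \<xi>$1 = x \<and> \<xi>$2 = y"
  by (auto simp: vec_eq_iff forall_2)

lemma norm_vector_2_squared: "(norm (\<xi> :: real^2))\<^sup>2 = (\<xi>$1)\<^sup>2 + (\<xi>$2)\<^sup>2"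
  unfolding power2_norm_eq_inner by (simp add: inner_vec_def sum_2 power2_eq_square)

lemma cot_gt_0: "0 < x \<Longrightarrow> x < pi / 2 \<Longrightarrow> 0 < cot (x::real)"
  by (simp add: cot_def sin_gt_zero cos_gt_zero_pi)

lemma sin_arcsin_quotient:
  assumes "0 < s" "s < (t::real)"
  shows "sin (arcsin (s / t)) = s / t" "0 < arcsin (s / t)" "arcsin (s / t) < pi / 2"
proof -
  have "0 < s / t" "s / t < 1"
    using assms by auto
  then show "sin (arcsin (s / t)) = s / t" "0 < arcsin (s / t)" "arcsin (s / t) < pi / 2"
    using arcsin_less_mono[of 0 "s / t"] arcsin_less_mono[of "s / t" 1] by simp_all
qed

text \<open>\<open>N\<close> and \<open>K\<close> are the components of the incoming velocity normal
  to the wing and along \<open>e_k\<close>, so the turning angle has tangent \<open>N / K\<close>.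
  Naming the square root of the polar \<open>m\<close> leaves a rational formula.\<close>

lemma q_down_eq:
  assumes c: "0 < c" and v1: "0 < v1_inf q \<alpha>" and \<alpha>: "sin \<alpha> \<noteq> 0" and \<beta>: "0 < cos \<beta>"
    and K_def: "K = v1_inf q \<alpha> * sin \<sigma> * sin \<beta> + v3_inf q \<alpha> * cos \<sigma>" and K: "0 < K"
    and N_def: "N = v1_inf q \<alpha> * cos \<beta>"
    and m: "0 < m" "N\<^sup>2 + K\<^sup>2 - c\<^sup>2 = m\<^sup>2"
  shows "q_down c q \<alpha> \<sigma> \<beta> = (N\<^sup>2 + K\<^sup>2) * m / (m * K + c * N)"
proof -
  define u where "u = sqrt (N\<^sup>2 + K\<^sup>2)"
  have u2: "u\<^sup>2 = N\<^sup>2 + K\<^sup>2" and u0: "0 < u"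
    using K by (simp_all add: u_def add_nonneg_pos)
  have N: "0 < N"
    using v1 \<beta> by (simp add: N_def)
  have q: "q \<noteq> 0"
    using v1 by (auto simp: v1_inf_def)
  have qt: "q_tilde q \<alpha> \<sigma> \<beta> = u"
    by (simp add: q_tilde_def u_def K_def N_def power_mult_distrib)
  have K': "K = v1_inf q \<alpha> * (sin \<sigma> * sin \<beta> + cot \<alpha> * cos \<sigma>)"
    using \<alpha> by (simp add: K_def v1_inf_def v3_inf_def cot_def field_simps)
  have tn: "tan (theta_n \<alpha> \<sigma> \<beta>) = N / K"
    using v1 unfolding theta_n_def tan_arctan K' N_def by simp
  have sm: "sqrt (u\<^sup>2 - c\<^sup>2) = m"
    using m by (simp add: u2)
  define U where "U = u * m / (m + c * (N / K))"
  have U: "0 < U"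
    using u0 m c N K by (simp add: U_def add_pos_pos)
  have pu: "polar_u u c (theta_n \<alpha> \<sigma> \<beta>) = U"
    unfolding polar_u_def sm tn U_def ..
  have "q_down c q \<alpha> \<sigma> \<beta> = sqrt (U\<^sup>2 + (U * (N / K))\<^sup>2)"
    unfolding q_down_def Let_def qt polar_v_def pu tn ..
  also have "U\<^sup>2 + (U * (N / K))\<^sup>2 = (U * u / K)\<^sup>2"
    using K by (simp add: power_mult_distrib power_divide u2 field_simps)
  also have "sqrt ((U * u / K)\<^sup>2) = U * u / K"
    using U u0 K by simp
  also have "\<dots> = u\<^sup>2 * m / (m * K + c * N)"
  proof -
    have "m * K + c * N = (m + c * (N / K)) * K"
      using K by (simp add: field_simps)
    then show ?thesis
      by (simp add: U_def power2_eq_square mult.commute)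
  qed
  finally show ?thesis
    unfolding u2 .
qed

section \<open>The incoming flow and the abscissa of \<open>P2\<close>\<close>

locale supersonic_flow =
  fixes c q \<alpha> :: real
  assumes c: "0 < c" and q: "0 < q" "q\<^sup>2 = 1 + c\<^sup>2"
    and \<alpha>: "0 < \<alpha>" "\<alpha> < alpha0 c q"
begin

abbreviation "v1 \<equiv> v1_inf q \<alpha>"
abbreviation "v3 \<equiv> v3_inf q \<alpha>"

text \<open>On the axis the cone equation is
  \<open>(v1^2 - 1) * x^2 + 2 * v1 * v3 * x + v3^2 - 1 = 0\<close>, with quarter discriminant
  \<open>c^2\<close>. This is one of its roots, written so that \<open>v1 = 1\<close> is
  covered.\<close>

definition X :: real where "X = - ((v3\<^sup>2 - 1) / (v1 * v3 + c))"

lemma c_less_q: "c < q"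
  by (rule power2_less_imp_less) (use q in auto)

lemma alpha_less: "\<alpha> < pi / 2"
  using \<alpha> sin_arcsin_quotient(3)[OF c c_less_q] by (simp add: alpha0_def)

lemma sin_alpha: "0 < sin \<alpha>"
  using \<alpha> alpha_less by (simp add: sin_gt_zero)

lemma v1_pos: "0 < v1"
  using sin_alpha q by (simp add: v1_inf_def)

text \<open>Taking sines in the bound on the attack angle shows that \<open>v1\<close> is subsonic.
  This yields \<open>1 < v3\<close> and later rejects the second root on the axis.\<close>

lemma v1_less_c: "v1 < c"
proof -
  have "sin \<alpha> < sin (arcsin (c / q))"
    using \<alpha> alpha_less sin_arcsin_quotient(3)[OF c c_less_q]
    by (intro sin_monotone_2pi) (auto simp: alpha0_def)
  then show ?thesis
    using q by (simp add: sin_arcsin_quotient(1)[OF c c_less_q] v1_inf_def field_simps)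
qed

lemma speed_decomposition: "v1\<^sup>2 + v3\<^sup>2 = 1 + c\<^sup>2"
proof -
  have "v1\<^sup>2 + v3\<^sup>2 = q\<^sup>2 * ((sin \<alpha>)\<^sup>2 + (cos \<alpha>)\<^sup>2)"
    unfolding v1_inf_def v3_inf_def by algebra
  then show ?thesis
    by (simp add: q)
qed

lemma v3_pos: "0 < v3"
  using \<alpha> alpha_less q by (simp add: v3_inf_def cos_gt_zero_pi)

lemma v1_squared_less: "v1\<^sup>2 < c\<^sup>2"
  using v1_less_c v1_pos by (simp add: power_strict_mono)

lemma v3_gt_1: "1 < v3"
proof (rule power2_less_imp_less)
  show "1\<^sup>2 < v3\<^sup>2"
    using v1_squared_less speed_decomposition by simp
qed (use v3_pos in simp)

lemma denominator_pos: "0 < v1 * v3 + c"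
  using v1_pos v3_pos c by (simp add: add_pos_pos)

lemma X_neg: "X < 0"
  using v3_gt_1 denominator_pos by (simp add: X_def)

lemma X_potential: "v1 * X + v3 = (c * v3 + v1) / (v1 * v3 + c)"
  using denominator_pos by (simp add: X_def field_simps power2_eq_square)

lemma X_potential_pos: "0 < v1 * X + v3"
  unfolding X_potential using v1_pos v3_pos c by (simp add: add_pos_pos)

lemma X_on_cone: "(v1 * X + v3)\<^sup>2 = 1 + X\<^sup>2"
proof -
  have "(c * v3 + v1)\<^sup>2 = (v1 * v3 + c)\<^sup>2 + (v3\<^sup>2 - 1)\<^sup>2"
    using speed_decomposition by algebra
  then show ?thesis
    unfolding X_potential using denominator_pos
    by (simp add: X_def power_divide field_simps)
qed

text \<open>\<open>v3^2 - 1 = c^2 - v1^2\<close> lies below \<open>c^2\<close>, hence below the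
  squared denominator of \<open>X\<close>. The bound is the squared cotangent of
  \<open>sigma0 c q \<alpha>\<close>.\<close>

lemma X_squared_less: "X\<^sup>2 < v3\<^sup>2 - 1"
proof -
  have "v3\<^sup>2 - 1 < (v1 * v3 + c)\<^sup>2"
    using speed_decomposition v1_pos v3_pos c
    by (simp add: power2_sum add_pos_pos)
       (smt (verit) mult_pos_pos zero_less_power)
  then have "(v3\<^sup>2 - 1) * (v3\<^sup>2 - 1) < (v3\<^sup>2 - 1) * (v1 * v3 + c)\<^sup>2"
    using v3_gt_1 by (intro mult_strict_left_mono) simp_all
  then show ?thesis
    using denominator_pos by (simp add: X_def power_divide divide_less_eq flip: power2_eq_square)
qed

text \<open>Closes the shock polar computation in \<open>q_down_critical\<close>, where this product
  appears.\<close>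

lemma X_potential_mult: "(v1 * X + v3) * (v3 + c * v1) = 1 + c\<^sup>2"
proof -
  have "(c * v3 + v1) * (v3 + c * v1) = (1 + c\<^sup>2) * (v1 * v3 + c)"
    using speed_decomposition by algebra
  then show ?thesis
    unfolding X_potential using denominator_pos by (simp add: field_simps)
qed

section \<open>The Mach cone of the incoming flow and its tangent at \<open>P2\<close>\<close>

lemma conical_pot_vel_inf: "conical_pot (vel_inf q \<alpha>) \<xi> = v1 * \<xi>$1 + v3"
  by (simp add: conical_pot_def vel_inf_def)

lemma in_C_inf_iff:
  "\<xi> \<in> C_inf q \<alpha> \<longleftrightarrow> 0 < v1 * \<xi>$1 + v3 \<and> (v1 * \<xi>$1 + v3)\<^sup>2 = 1 + (\<xi>$1)\<^sup>2 + (\<xi>$2)\<^sup>2"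
  by (simp add: C_inf_def mach_cone_def conical_pot_vel_inf norm_vector_2_squared add.assoc)

lemma C_inf_axis_iff: "x < 0 \<and> vector [x, 0] \<in> C_inf q \<alpha> \<longleftrightarrow> x = X"
proof
  assume "x = X"
  then show "x < 0 \<and> vector [x, 0] \<in> C_inf q \<alpha>"
    by (simp add: in_C_inf_iff X_neg X_potential_pos X_on_cone)
next
  assume "x < 0 \<and> vector [x, 0] \<in> C_inf q \<alpha>"
  then have x: "x < 0" "0 < v1 * x + v3" "(v1 * x + v3)\<^sup>2 = 1 + x\<^sup>2"
    by (simp_all add: in_C_inf_iff)
  \<comment> \<open>The cone equation times \<open>v3^2 - 1\<close> splits into linear factors,
    because \<open>v1^2 * v3^2 - c^2 = (v1^2 - 1) * (v3^2 - 1)\<close>.\<close>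
  have "((v1 * v3 + c) * x + (v3\<^sup>2 - 1)) * ((v1 * v3 - c) * x + (v3\<^sup>2 - 1)) = 0"
    using x(3) speed_decomposition by algebra
  moreover have "(v1 * v3 - c) * x + (v3\<^sup>2 - 1) \<noteq> 0"
  proof
    assume root: "(v1 * v3 - c) * x + (v3\<^sup>2 - 1) = 0"
    have "0 < v3\<^sup>2 - 1"
      using v3_gt_1 by simp
    with root x(1) have pos: "0 < v1 * v3 - c"
      by (smt (verit) mult_nonpos_nonpos)
    \<comment> \<open>A negative second root has negative potential, so it lies on the other
      branch.\<close>
    have "(v1 * v3 - c) * (v1 * x + v3) = v1 - c * v3"
      using root by algebra
    moreover have "v1 < c * v3"
      using v1_less_c v3_gt_1 c by (smt (verit) mult_less_cancel_left2)
    ultimately show False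
      using pos x(2) by (smt (verit) mult_pos_pos)
  qed
  ultimately have "(v1 * v3 + c) * x + (v3\<^sup>2 - 1) = 0"
    by simp
  then show "x = X"
    using denominator_pos by (simp add: X_def field_simps)
qed

lemma xi1_P2_eq: "xi1_P2 q \<alpha> = X"
  unfolding xi1_P2_def C_inf_axis_iff by simp

lemma P2_eq: "P2 q \<alpha> = vector [X, 0]"
  by (simp add: P2_def xi1_P2_eq)

text \<open>With \<open>\<xi>$1 = X\<close> the cone equation collapses to
  \<open>(\<xi>$2)^2 = 0\<close>.\<close>

lemma C_inf_above_X: "\<xi> \<in> C_inf q \<alpha> \<and> \<xi>$1 = X \<longleftrightarrow> \<xi> = P2 q \<alpha>"
  using X_potential_pos X_on_cone by (auto simp: in_C_inf_iff P2_eq vector_2_eq_iff)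

text \<open>The Mach cone near \<open>P2\<close> is parametrized by \<open>\<xi>\<^sub>2 = t\<close>. The quadratic equation for \<open>\<xi>\<^sub>1\<close> is solved
  in its rationalized form because its leading coefficient \<open>v1\<^sup>2 - 1\<close> may vanish.\<close>

lemma tangent_line_at_P2: "tangent_line_at {\<xi>. \<xi>$1 = X} (C_inf q \<alpha>) (P2 q \<alpha>)"
proof -
  \<comment> \<open>\<open>(r t)^2\<close> is the quarter discriminant of the quadratic for \<xi>1
    at height \<open>t\<close>.\<close>
  define r where "r t = sqrt (c\<^sup>2 + (v1\<^sup>2 - 1) * t\<^sup>2)" for t
  define x where "x t = - ((v3\<^sup>2 - 1 - t\<^sup>2) / (v1 * v3 + r t))" for t
  define \<gamma> :: "real \<Rightarrow> real^2" where "\<gamma> t = x t *\<^sub>R axis 1 1 + t *\<^sub>R axis 2 1" for t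
  have \<gamma>_nth: "\<gamma> t $ 1 = x t" "\<gamma> t $ 2 = t" for t
    by (simp_all add: \<gamma>_def axis_def)
  have r0: "r 0 = c"
    using c by (simp add: r_def)
  have x0: "x 0 = X"
    by (simp add: x_def X_def r0)
  \<comment> \<open>Both \<open>r\<close> and \<open>x\<close> depend on \<open>t\<close> only
    through \<open>t^2\<close>, so their derivatives vanish at 0 and the curve leaves
    \<open>P2\<close> parallel to the \<xi>2-axis.\<close>
  have dr: "(r has_real_derivative 0) (at 0)"
    unfolding r_def using c by (auto intro!: derivative_eq_intros)
  have dx: "(x has_real_derivative 0) (at 0)"
    unfolding x_def using denominator_pos
    by (auto intro!: derivative_eq_intros dr simp: r0)
  have "isCont x 0"
    using dx by (rule DERIV_isCont)
  then have "((\<lambda>t. v1 * x t + v3) \<longlongrightarrow> v1 * X + v3) (nhds 0)"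
    unfolding continuous_at tendsto_at_iff_tendsto_nhds x0[symmetric]
    by (intro tendsto_intros)
  then have ev1: "\<forall>\<^sub>F t in nhds 0. 0 < v1 * x t + v3"
    using X_potential_pos by (rule order_tendstoD)
  have "((\<lambda>t. c\<^sup>2 + (v1\<^sup>2 - 1) * t\<^sup>2) \<longlongrightarrow> c\<^sup>2 + (v1\<^sup>2 - 1) * 0\<^sup>2) (nhds 0)"
    by (intro tendsto_intros filterlim_ident)
  then have ev2: "\<forall>\<^sub>F t in nhds 0. 0 < c\<^sup>2 + (v1\<^sup>2 - 1) * t\<^sup>2"
    by (rule order_tendstoD) (use c in simp)
  have on_cone: "\<gamma> t \<in> C_inf q \<alpha>"
    if t: "0 < v1 * x t + v3" "0 < c\<^sup>2 + (v1\<^sup>2 - 1) * t\<^sup>2" for t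
  proof -
    have r: "0 < r t" "(r t)\<^sup>2 = c\<^sup>2 + (v1\<^sup>2 - 1) * t\<^sup>2"
      using t(2) by (simp_all add: r_def)
    define d where "d = v1 * v3 + r t"
    have d: "0 < d"
      using v1_pos v3_pos r by (simp add: d_def add_pos_pos)
    have "d * x t = - (v3\<^sup>2 - 1 - t\<^sup>2)"
      using d by (simp add: x_def d_def)
    \<comment> \<open>The quadratic for \<open>x t\<close> restated for its denominator
      \<open>d\<close>; this form involves no division by \<open>v3^2 - 1 - t^2\<close>.\<close>
    moreover have "d\<^sup>2 = 2 * v1 * v3 * d - (v1\<^sup>2 - 1) * (v3\<^sup>2 - 1 - t\<^sup>2)"
      using r(2) speed_decomposition unfolding d_def by algebra
    ultimately have "d\<^sup>2 * ((v1 * x t + v3)\<^sup>2 - (1 + (x t)\<^sup>2 + t\<^sup>2)) = 0"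
      by algebra
    then have "(v1 * x t + v3)\<^sup>2 = 1 + (x t)\<^sup>2 + t\<^sup>2"
      using d by simp
    with t(1) show ?thesis
      by (simp add: in_C_inf_iff \<gamma>_nth)
  qed
  have "\<gamma> 0 = P2 q \<alpha>"
    by (simp add: P2_eq vector_2_eq_iff \<gamma>_nth x0)
  moreover have "\<forall>\<^sub>F t in nhds 0. \<gamma> t \<in> C_inf q \<alpha>"
    using ev1 ev2 by eventually_elim (rule on_cone)
  moreover have "(\<gamma> has_vector_derivative axis 2 1) (at 0)"
    unfolding \<gamma>_def using dx by (auto intro!: derivative_eq_intros)
  moreover have "axis 2 1 \<noteq> (0 :: real^2)"
    by simp
  moreover have "{\<xi>. \<xi>$1 = X} = range (\<lambda>t. P2 q \<alpha> + t *\<^sub>R axis 2 1)" (is "?L = ?R")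
  proof
    show "?L \<subseteq> ?R"
    proof
      fix \<xi> :: "real^2"
      assume "\<xi> \<in> ?L"
      then have "\<xi> = P2 q \<alpha> + (\<xi>$2) *\<^sub>R axis 2 1"
        by (simp add: P2_eq vec_eq_iff forall_2 axis_def)
      then show "\<xi> \<in> ?R"
        by blast
    qed
    show "?R \<subseteq> ?L"
      by (auto simp: P2_eq axis_def)
  qed
  ultimately show ?thesis
    unfolding tangent_line_at_def by blast
qed

text \<open>A point of tangency lies on both the line and the cone, which share only
  \<open>P2\<close>. This makes the description of \<open>P1\<close> unique.\<close>

lemma tangent_line_at_X_iff: "tangent_line_at {\<xi>. \<xi>$1 = X} (C_inf q \<alpha>) P \<longleftrightarrow> P = P2 q \<alpha>"
proof
  assume "tangent_line_at {\<xi>. \<xi>$1 = X} (C_inf q \<alpha>) P"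
  then obtain \<gamma> :: "real \<Rightarrow> real^2" and v where \<gamma>: "\<gamma> 0 = P" "\<forall>\<^sub>F t in nhds 0. \<gamma> t \<in> C_inf q \<alpha>"
    and L: "{\<xi>. \<xi>$1 = X} = range (\<lambda>t. P + t *\<^sub>R v)"
    unfolding tangent_line_at_def by blast
  have "P \<in> C_inf q \<alpha>"
    using eventually_nhds_x_imp_x[OF \<gamma>(2)] \<gamma>(1) by simp
  moreover have "P + 0 *\<^sub>R v \<in> {\<xi>. \<xi>$1 = X}"
    unfolding L by (rule rangeI)
  ultimately show "P = P2 q \<alpha>"
    using C_inf_above_X by auto
qed (simp add: tangent_line_at_P2)

section \<open>Admissible sweep angles\<close>

lemma sigma_less:
  assumes "\<sigma> \<le> sigma0 c q \<alpha>"
  shows "\<sigma> < pi / 2"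
  using assms sin_arcsin_quotient(3)[OF zero_less_one v3_gt_1] q
  by (simp add: sigma0_def)

text \<open>By the normalization, \<open>\<sigma> \<le> sigma0 c q \<alpha>\<close> amounts to
  \<open>sin \<sigma> \<le> 1 / v3\<close>, so \<open>cot \<sigma>\<close> squared is at least
  \<open>v3^2 - 1\<close>. The result keeps the argument of the arcsine below 1.\<close>

lemma neg_X_less_cot:
  assumes "0 < \<sigma>" "\<sigma> \<le> sigma0 c q \<alpha>"
  shows "- X < cot \<sigma>"
proof (rule power2_less_imp_less)
  have s: "0 < sin \<sigma>"
    using assms sigma_less[of \<sigma>] by (simp add: sin_gt_zero)
  have "sin \<sigma> \<le> sin (arcsin (1 / v3))"
    using assms sin_arcsin_quotient(3)[OF zero_less_one v3_gt_1] q
    by (intro sin_monotone_2pi_le) (auto simp: sigma0_def)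
  then have "sin \<sigma> * v3 \<le> 1"
    using v3_pos sin_arcsin_quotient(1)[OF zero_less_one v3_gt_1] by (simp add: field_simps)
  then have "(sin \<sigma> * v3)\<^sup>2 \<le> 1"
    using s v3_pos by (simp add: power_le_one)
  then have "v3\<^sup>2 - 1 \<le> (cot \<sigma>)\<^sup>2"
    using s by (simp add: cot_def power_divide cos_squared_eq field_simps power_mult_distrib)
  then show "(- X)\<^sup>2 < (cot \<sigma>)\<^sup>2"
    using X_squared_less by simp
  show "0 \<le> cot \<sigma>"
    using cot_gt_0 assms sigma_less by force
qed

end

section \<open>The flow at the critical anhedral angle\<close>

locale critical_wing = supersonic_flow +
  fixes \<sigma> \<beta> :: real
  assumes \<sigma>: "0 < \<sigma>" "\<sigma> < pi / 2" and \<beta>: "0 < \<beta>" "\<beta> < pi / 2"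
    and critical: "cot \<sigma> * sin \<beta> = - X"
begin

lemma trig_pos: "0 < sin \<sigma>" "0 < cos \<sigma>" "0 < sin \<beta>" "0 < cos \<beta>"
  using \<sigma> \<beta> by (simp_all add: sin_gt_zero cos_gt_zero_pi)

lemma critical': "cos \<sigma> * sin \<beta> = - X * sin \<sigma>"
  using critical trig_pos(1) by (simp add: cot_def field_simps)

text \<open>At the critical angle the square root in the polar simplifies to
  \<open>cos \<sigma> * cos \<beta>\<close>. The value is the \<open>e_k\<close> component of the
  expected velocity \<open>(0, 0, v1 * X + v3)\<close>.\<close>

lemma q_down_critical: "q_down c q \<alpha> \<sigma> \<beta> = (v1 * X + v3) * cos \<sigma>"
proof -
  define F where "F = v1 * X + v3"
  define K where "K = v1 * sin \<sigma> * sin \<beta> + v3 * cos \<sigma>"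
  define N where "N = v1 * cos \<beta>"
  define m where "m = cos \<sigma> * cos \<beta>"
  have sc: "(sin \<sigma>)\<^sup>2 + (cos \<sigma>)\<^sup>2 = 1" "(sin \<beta>)\<^sup>2 + (cos \<beta>)\<^sup>2 = 1"
    by simp_all
  have K: "0 < K"
    using v1_pos v3_pos trig_pos by (simp add: K_def add_pos_pos)
  have N: "0 < N" and m: "0 < m"
    using v1_pos trig_pos by (simp_all add: N_def m_def)
  have F2: "F\<^sup>2 = 1 + X\<^sup>2"
    using X_on_cone by (simp add: F_def)
  have cosK: "cos \<sigma> * K = v3 - (sin \<sigma>)\<^sup>2 * F"
    using critical' sc(1) unfolding K_def F_def by algebra
  have normal: "N\<^sup>2 + K\<^sup>2 = 1 + c\<^sup>2 - (sin \<sigma> * F)\<^sup>2"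
  proof -
    \<comment> \<open>Pythagoras: \<open>N\<close> and \<open>K\<close> are what remains of the
      incoming velocity after removing its component along \<open>e_j\<close>.\<close>
    have "N\<^sup>2 + K\<^sup>2 = v1\<^sup>2 + v3\<^sup>2 - (v3 * sin \<sigma> - v1 * (cos \<sigma> * sin \<beta>))\<^sup>2"
      using sc unfolding K_def N_def by algebra
    also have "v3 * sin \<sigma> - v1 * (cos \<sigma> * sin \<beta>) = sin \<sigma> * F"
      unfolding critical' F_def by algebra
    finally show ?thesis
      using speed_decomposition by simp
  qed
  have "1 - (sin \<sigma> * F)\<^sup>2 = (cos \<sigma>)\<^sup>2 - (X * sin \<sigma>)\<^sup>2"
    using F2 sc(1) by algebra
  also have "\<dots> = m\<^sup>2"
    using critical' sc(2) unfolding m_def by algebra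
  finally have "N\<^sup>2 + K\<^sup>2 - c\<^sup>2 = m\<^sup>2"
    using normal by simp
  then have "q_down c q \<alpha> \<sigma> \<beta> = (N\<^sup>2 + K\<^sup>2) * m / (m * K + c * N)"
    using q_down_eq[OF c v1_pos _ trig_pos(4) K_def K N_def m] sin_alpha by simp
  also have "\<dots> = F * cos \<sigma>"
  proof -
    have "F * cos \<sigma> * (m * K + c * N) = m * (F * (cos \<sigma> * K + c * v1))"
      unfolding m_def N_def by algebra
    \<comment> \<open>By \<open>cosK\<close> the left side is
      \<open>F * (v3 + c * v1) - (sin \<sigma> * F)^2\<close>, and \<open>X_potential_mult\<close>
      evaluates the first term.\<close>
    also have "F * (cos \<sigma> * K + c * v1) = N\<^sup>2 + K\<^sup>2"
      unfolding normal cosK using X_potential_mult unfolding F_def[symmetric] by algebra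
    finally have "F * cos \<sigma> * (m * K + c * N) = (N\<^sup>2 + K\<^sup>2) * m"
      by (simp only: mult.commute)
    moreover have "0 < m * K + c * N"
      using m K N c by (simp add: add_pos_pos)
    ultimately show ?thesis
      by (simp add: divide_eq_eq)
  qed
  finally show ?thesis
    by (simp add: F_def)
qed

text \<open>The components along \<open>e_j\<close> and \<open>e_k\<close> are
  \<open>F * sin \<sigma>\<close> and \<open>F * cos \<sigma>\<close>, and
  \<open>sin \<sigma> * e_j + cos \<sigma> * e_k\<close> is the third unit vector.\<close>

lemma vel_down_critical: "vel_down c q \<alpha> \<sigma> \<beta> = vector [0, 0, v1 * X + v3]"
proof -
  define F where "F = v1 * X + v3"
  have A: "v3 * sin \<sigma> - v1 * cos \<sigma> * sin \<beta> = sin \<sigma> * F"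
    using critical' unfolding F_def by algebra
  have "sin \<sigma> * F * sin \<sigma> + F * cos \<sigma> * cos \<sigma> = F * ((sin \<sigma>)\<^sup>2 + (cos \<sigma>)\<^sup>2)"
    by algebra
  then show ?thesis
    unfolding vel_down_def q_down_critical A F_def[symmetric]
    by (simp add: vec_eq_iff forall_3 e_j_def e_k_def)
qed

lemma S_ob_critical: "S_ob c q \<alpha> \<sigma> \<beta> = {\<xi>. \<xi>$1 = X}"
  unfolding S_ob_def conical_pot_vel_inf vel_down_critical
  using v1_pos by (auto simp: conical_pot_def)

lemma P1_critical: "P1 c q \<alpha> \<sigma> \<beta> = P2 q \<alpha>"
  unfolding P1_def S_ob_critical tangent_line_at_X_iff by simp

lemma curved_shock_critical: "curved_shock c q \<alpha> \<sigma> \<beta> = {P2 q \<alpha>}"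
  using C_inf_above_X unfolding curved_shock_def P1_critical by (auto simp: P2_eq)

lemma attached_shock_critical:
  "attached_shock c q \<alpha> \<sigma> \<beta> = closed_segment (P5 \<sigma> \<beta>) (P2 q \<alpha>)"
  unfolding attached_shock_def P1_critical curved_shock_critical by auto

text \<open>The critical condition puts \<open>P5\<close> on the line \<xi>1 = \<open>X\<close> as
  well, and a segment stays on the line through its ends.\<close>

lemma attached_shock_subset: "attached_shock c q \<alpha> \<sigma> \<beta> \<subseteq> S_ob c q \<alpha> \<sigma> \<beta>"
proof -
  have "P5 \<sigma> \<beta> $ 1 = X" "P2 q \<alpha> $ 1 = X"
    using critical by (simp_all add: P5_def P2_eq)
  then show ?thesis
    unfolding attached_shock_critical S_ob_critical
    by (auto simp: closed_segment_def simp flip: distrib_right)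
qed

lemma planar_shock_surface: "planar (shock_surface c q \<alpha> \<sigma> \<beta>)"
proof -
  \<comment> \<open>Normal of the plane \<open>x$1 = X * x$3\<close>, the cone over the shock line.
    Its equation does not involve \<open>x$2\<close>, so both symmetric halves of the surface lie in
    it.\<close>
  let ?n = "vector [1, 0, - X] :: real^3"
  have "?n \<bullet> x = 0" if "x \<in> shock_surface c q \<alpha> \<sigma> \<beta>" for x
  proof -
    have "0 < x$3" "x$1 / x$3 = X"
      using that attached_shock_subset
      by (auto simp: shock_surface_def S_ob_critical)
    then have "x$1 = X * x$3"
      by (simp add: field_simps)
    then show ?thesis
      by (simp add: inner_vec_def sum_3)
  qed
  moreover have "?n \<noteq> 0"
    by (simp add: vec_eq_iff forall_3)
  ultimately show ?thesis
    unfolding planar_def by blast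
qed

end

theorem lemma2p1:
  fixes a \<rho> c q \<alpha> \<sigma> :: real
  assumes "a > 0" and "\<rho> > 0" and "c = sound_speed a \<rho>"
    and "q > c" and "q\<^sup>2 - c\<^sup>2 = 1"
    and "0 < \<alpha>" and "\<alpha> < alpha0 c q"
    and "0 < \<sigma>" and "\<sigma> \<le> sigma0 c q \<alpha>"
  shows "(\<exists>!x. x < 0 \<and> vector [x, 0] \<in> C_inf q \<alpha>) \<and>
    (\<exists>\<beta>\<^sub>c. \<beta>\<^sub>c = arcsin (- xi1_P2 q \<alpha> / cot \<sigma>) \<and> 0 < \<beta>\<^sub>c \<and> \<beta>\<^sub>c < pi / 2 \<and>
       (\<exists>!P. tangent_line_at (S_ob c q \<alpha> \<sigma> \<beta>\<^sub>c) (C_inf q \<alpha>) P) \<and>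
       P1 c q \<alpha> \<sigma> \<beta>\<^sub>c = P2 q \<alpha> \<and>
       curved_shock c q \<alpha> \<sigma> \<beta>\<^sub>c = {P2 q \<alpha>} \<and>
       attached_shock c q \<alpha> \<sigma> \<beta>\<^sub>c = closed_segment (P5 \<sigma> \<beta>\<^sub>c) (P2 q \<alpha>) \<and>
       attached_shock c q \<alpha> \<sigma> \<beta>\<^sub>c \<subseteq> S_ob c q \<alpha> \<sigma> \<beta>\<^sub>c \<and>
       planar (shock_surface c q \<alpha> \<sigma> \<beta>\<^sub>c))"
proof -
  have c: "0 < c"
    using assms(1-3) by (simp add: sound_speed_def)
  interpret supersonic_flow c q \<alpha>
    using c assms(4-7) by unfold_locales simp_all
  define \<beta> where "\<beta> = arcsin (- xi1_P2 q \<alpha> / cot \<sigma>)"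
  have less: "0 < - X" "- X < cot \<sigma>"
    using X_neg neg_X_less_cot assms(8,9) by simp_all
  have "\<beta> = arcsin (- X / cot \<sigma>)"
    by (simp add: \<beta>_def xi1_P2_eq)
  \<comment> \<open>\<open>sin \<beta> = - X / cot \<sigma>\<close> is the assumption
    \<open>critical\<close> of the locale after clearing the denominator.\<close>
  note sin_\<beta> = sin_arcsin_quotient[OF less, folded this]
  interpret critical_wing c q \<alpha> \<sigma> \<beta>
    using assms(8,9) sigma_less sin_\<beta> less
    by unfold_locales simp_all
  show ?thesis
  proof (intro conjI exI[of _ \<beta>])
    show "\<exists>!x. x < 0 \<and> vector [x, 0] \<in> C_inf q \<alpha>"
      unfolding C_inf_axis_iff by simp
    show "\<exists>!P. tangent_line_at (S_ob c q \<alpha> \<sigma> \<beta>) (C_inf q \<alpha>) P"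
      unfolding S_ob_critical tangent_line_at_X_iff by simp
  qed (fact \<beta>_def sin_\<beta> P1_critical curved_shock_critical attached_shock_critical
      attached_shock_subset planar_shock_surface)+
qed

end
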